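(* Let $F_n$ be the friendship graph with $n\ge 2$. Then $\gamma_{tc}(M(F_n))=2n+1$.
   Context: All graphs are finite, simple and undirected. The friendship graph $F_n$ is the graph of order $2n+1$ obtained by joining $n$ copies of the cycle $C_3$ at a common vertex; i.e., vertices $v_0,\dots,v_{2n}$ and edges $v_0v_i$ ($1\le i\le 2n$) and $v_{2k-1}v_{2k}$ ($1\le k\le n$). For a graph $H$, a set $D\subseteq V(H)$ is a total dominating set if every vertex of $H$ has a neighbor in $D$. A set $D\subseteq V(H)$ is a total outer-connected dominating set of $H$ if $D$ is a total dominating set and the induced subgraph $H[V(H)\setminus D]$ is connected; $\gamma_{tc}(H)$ denotes the minimum cardinality of a total outer-connected dominating set of $H$. The middle graph $M(G)$ of a graph $G$ has vertex set $V(G)\cup E(G)$, where two elements $x,y$ are adjacent iff either $x,y\in E(G)$ are edges of $G$ sharing an endpoint, or one of them is a vertex of $G$ and the other is an edge of $G$ incident to it. *)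

theory Defs
  imports "Graph_Theory.Graph_Theory"
begin

text \<open>
  A finite simple undirected graph is a \<^locale>\<open>pair_graph\<close>: a finite vertex set with a symmetric,
  irreflexive set of arcs, where an undirected edge \<open>uv\<close> is given by the two arcs \<open>(u,v)\<close> and
  \<open>(v,u)\<close>. The undirected edges proper are the two-element sets \<open>{u,v}\<close>.
\<close>

definition edges :: "'a pair_pre_digraph \<Rightarrow> 'a set set" where
  "edges G = {{u, v} | u v. (u, v) \<in> parcs G}"

definition friendship_graph :: "nat \<Rightarrow> nat pair_pre_digraph" where
  "friendship_graph n =
    (let A = {(0, i) | i. 1 \<le> i \<and> i \<le> 2 * n} \<union> {(2 * k - 1, 2 * k) | k. 1 \<le> k \<and> k \<le> n}
     in \<lparr> pverts = {0..2 * n}, parcs = A \<union> A\<inverse> \<rparr>)"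

text \<open>
  The vertex set of the middle graph is the disjoint union of vertices (\<^const>\<open>Inl\<close>) and
  edges (\<^const>\<open>Inr\<close>).
\<close>

definition middle_graph :: "'a pair_pre_digraph \<Rightarrow> ('a + 'a set) pair_pre_digraph" where
  "middle_graph G =
    \<lparr> pverts = Inl ` pverts G \<union> Inr ` edges G,
      parcs = {(Inr e, Inr f) | e f. e \<in> edges G \<and> f \<in> edges G \<and> e \<noteq> f \<and> e \<inter> f \<noteq> {}}
        \<union> {(Inl v, Inr e) | v e. v \<in> pverts G \<and> e \<in> edges G \<and> v \<in> e}
        \<union> {(Inr e, Inl v) | v e. v \<in> pverts G \<and> e \<in> edges G \<and> v \<in> e} \<rparr>"

definition total_dominating_set :: "'a pair_pre_digraph \<Rightarrow> 'a set \<Rightarrow> bool" where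
  "total_dominating_set H D \<longleftrightarrow> D \<subseteq> pverts H \<and> (\<forall>v \<in> pverts H. \<exists>u \<in> D. (v, u) \<in> parcs H)"

text \<open>
  By the library's convention the graph without vertices is not connected, so \<open>D = V(H)\<close> is
  excluded below.
\<close>

definition total_outer_connected_dominating_set :: "'a pair_pre_digraph \<Rightarrow> 'a set \<Rightarrow> bool" where
  "total_outer_connected_dominating_set H D \<longleftrightarrow>
     total_dominating_set H D \<and> connected (with_proj H \<restriction> (pverts H - D))"

definition gamma_tc :: "'a pair_pre_digraph \<Rightarrow> nat" where
  "gamma_tc H = Min (card ` {D. total_outer_connected_dominating_set H D})"

lemma finite_edges:
  assumes "finite (parcs G)"
  shows "finite (edges G)"
proof -
  have "edges G = (\<lambda>(u, v). {u, v}) ` parcs G"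
    unfolding edges_def by force
  then show ?thesis using assms by simp
qed

lemma pair_graph_friendship_graph: "pair_graph (friendship_graph n)"
proof -
  have sub: "parcs (friendship_graph n) \<subseteq> {0..2 * n} \<times> {0..2 * n}"
    by (auto simp: friendship_graph_def Let_def)
  have v: "pverts (friendship_graph n) = {0..2 * n}"
    by (simp add: friendship_graph_def Let_def)
  show ?thesis
  proof
    show "finite (parcs (friendship_graph n))"
      using sub by (rule finite_subset) simp
    show "symmetric (with_proj (friendship_graph n))"
      by (auto simp: symmetric_def sym_def friendship_graph_def Let_def)
  next
    fix e assume "e \<in> parcs (friendship_graph n)"
    then show "fst e \<noteq> snd e"
      by (auto simp: friendship_graph_def Let_def)
  qed (use sub v in force)+
qed

lemma pair_graph_middle_graph:
  assumes "pair_graph G"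
  shows "pair_graph (middle_graph G)"
proof -
  interpret pair_graph G by fact
  have fin: "finite (pverts (middle_graph G))"
    by (simp add: middle_graph_def finite_edges)
  have sub: "parcs (middle_graph G) \<subseteq> pverts (middle_graph G) \<times> pverts (middle_graph G)"
    by (auto simp: middle_graph_def)
  show ?thesis
  proof
    show "finite (parcs (middle_graph G))"
      using sub by (rule finite_subset) (simp add: fin)
    show "symmetric (with_proj (middle_graph G))"
      by (auto simp: symmetric_def sym_def middle_graph_def)
  next
    fix e assume "e \<in> parcs (middle_graph G)"
    then show "fst e \<noteq> snd e"
      by (auto simp: middle_graph_def)
  qed (use sub fin in force)+
qed

end

theory Submission
  imports Defs
begin

text \<open>
  Write \<open>m\<^sub>i\<close> for the hub edge \<open>v\<^sub>0v\<^sub>i\<close> and \<open>r\<^sub>k\<close> for the rim edge \<open>v\<^bsub>2k-1\<^esub>v\<^bsub>2k\<^esub>\<close>. Apart from \<open>v\<^sub>0\<close>, the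
  middle graph splits into \<open>n\<close> blocks \<open>{v\<^sub>a, v\<^sub>b, m\<^sub>a, m\<^sub>b, r}\<close>, and a total dominating set \<open>D\<close> meets
  each block at least twice: it contains both hub edges, or else \<open>r\<close> together with a neighbour of
  \<open>r\<close>, and these all lie in the block. If \<open>card D \<le> 2n\<close>, then \<open>v\<^sub>0 \<notin> D\<close> and every block is met
  exactly twice. A hub edge \<open>m\<^sub>a \<in> D\<close> dominating \<open>v\<^sub>0\<close> leaves for its block only \<open>{m\<^sub>a, m\<^sub>b}\<close> and
  \<open>{m\<^sub>a, r}\<close>, which cut off \<open>{v\<^sub>a, v\<^sub>b, r}\<close> and \<open>{v\<^sub>a}\<close> respectively from \<open>v\<^sub>0\<close>. The bound is attained
  by taking \<open>r\<^sub>k\<close> and \<open>v\<^bsub>2k-1\<^esub>\<close> for all \<open>k\<close>, together with \<open>m\<^sub>1\<close>.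
\<close>

section \<open>Connectivity of induced subgraphs\<close>

text \<open>\<open>connected\<close> means strong connectivity of the symmetric closure.
  \<open>H\<close> is already symmetric, so the closure adds no arc to the induced subgraph.\<close>

lemma mk_symmetric_induce:
  assumes "pair_graph H"
  shows "mk_symmetric (with_proj H \<restriction> S) = \<lparr>pverts = S, parcs = parcs H \<inter> S \<times> S\<rparr>"
proof -
  interpret pair_graph H by fact
  have "(v, u) \<in> parcs H" if "(u, v) \<in> parcs H" for u v
    using graph_symmetric[of u v] that by simp
  then show ?thesis
    by (force simp: mk_symmetric_def)
qed

text \<open>Paths into a single centre \<open>c\<close> suffice: symmetry reverses them, and any two
  vertices are then joined through \<open>c\<close>.\<close>

lemma connected_induceI:
  assumes H: "pair_graph H" and c: "c \<in> S"
    and reach: "\<And>u. u \<in> S \<Longrightarrow> (u, c) \<in> (parcs H \<inter> S \<times> S)\<^sup>*"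
  shows "connected (with_proj H \<restriction> S)"
proof -
  let ?K = "\<lparr>pverts = S, parcs = parcs H \<inter> S \<times> S\<rparr>"
  interpret K: pair_wf_digraph ?K
    by unfold_locales auto
  have to_c: "u \<rightarrow>\<^sup>*\<^bsub>with_proj ?K\<^esub> c" if "u \<in> S" for u
    using reach[OF that] that by (simp add: K.reachable_conv')
  have "symmetric (with_proj ?K)"
    using symmetric_mk_symmetric[of "with_proj H \<restriction> S"] by (simp add: mk_symmetric_induce[OF H])
  then have from_c: "c \<rightarrow>\<^sup>*\<^bsub>with_proj ?K\<^esub> u" if "u \<in> S" for u
    using to_c[OF that] by (rule symmetric_reachable)
  have "strongly_connected (with_proj ?K)"
  proof
    show "verts (with_proj ?K) \<noteq> {}"
      using c by auto
    show "u \<rightarrow>\<^sup>*\<^bsub>with_proj ?K\<^esub> v" if "u \<in> verts (with_proj ?K)" "v \<in> verts (with_proj ?K)" for u v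
      using that to_c[of u] from_c[of v] by (auto intro: K.reachable_trans)
  qed
  then show ?thesis
    by (simp add: connected_def mk_symmetric_induce[OF H])
qed

text \<open>The invariant \<open>A\<close> is preserved along every path inside \<open>S\<close>.
  Used contrapositively: a closed set that misses a vertex of \<open>S\<close> refutes
  connectivity.\<close>

lemma connected_induce_closed:
  assumes H: "pair_graph H" and con: "connected (with_proj H \<restriction> S)"
    and u: "u \<in> A" "u \<in> S" and v: "v \<in> S"
    and closed: "\<And>x y. x \<in> A \<Longrightarrow> y \<in> S \<Longrightarrow> (x, y) \<in> parcs H \<Longrightarrow> y \<in> A"
  shows "v \<in> A"
proof -
  let ?K = "\<lparr>pverts = S, parcs = parcs H \<inter> S \<times> S\<rparr>"
  have "u \<rightarrow>\<^sup>*\<^bsub>with_proj ?K\<^esub> v"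
    using con u v by (simp add: connected_def mk_symmetric_induce[OF H] strongly_connected_def)
  then have "(u, v) \<in> rtrancl_on S (parcs H \<inter> S \<times> S)"
    by (simp add: reachable_def)
  then show ?thesis
    by (induction rule: rtrancl_on_induct) (use u closed in auto)
qed

section \<open>The middle graph of the friendship graph\<close>

lemma pverts_friendship_graph: "pverts (friendship_graph n) = {0..2 * n}"
  by (simp add: friendship_graph_def Let_def)

lemma edges_friendship_graph:
  "edges (friendship_graph n) =
    {{0, i} | i. 1 \<le> i \<and> i \<le> 2 * n} \<union> {{2 * k - 1, 2 * k} | k. 1 \<le> k \<and> k \<le> n}"
  unfolding edges_def friendship_graph_def Let_def
  by (auto simp: insert_commute)

lemma middle_vertex_cases:
  assumes "v \<in> pverts (middle_graph (friendship_graph n))"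
  obtains (centre) "v = Inl 0"
    | (outer) i where "1 \<le> i" "i \<le> 2 * n" "v = Inl i"
    | (hub) i where "1 \<le> i" "i \<le> 2 * n" "v = Inr {0, i}"
    | (rim) k where "1 \<le> k" "k \<le> n" "v = Inr {2 * k - 1, 2 * k}"
proof (cases v)
  case (Inl i)
  then have "i \<le> 2 * n"
    using assms by (auto simp: middle_graph_def pverts_friendship_graph)
  then show ?thesis
    using Inl centre outer[of i] by (cases "i = 0") auto
next
  case (Inr e)
  then have "e \<in> edges (friendship_graph n)"
    using assms by (auto simp: middle_graph_def)
  then show ?thesis
    using Inr hub rim by (auto simp: edges_friendship_graph)
qed

definition rim_pair :: "nat \<Rightarrow> nat \<Rightarrow> nat \<Rightarrow> bool" where
  "rim_pair n a b \<longleftrightarrow>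
    (\<exists>k. 1 \<le> k \<and> k \<le> n \<and> (a = 2 * k - 1 \<and> b = 2 * k \<or> a = 2 * k \<and> b = 2 * k - 1))"

lemma rim_pair_commute: "rim_pair n a b \<longleftrightarrow> rim_pair n b a"
  unfolding rim_pair_def by auto

lemma rim_pair_exists:
  assumes "1 \<le> i" "i \<le> 2 * n"
  obtains b where "rim_pair n i b"
proof (cases "even i")
  case True
  then show ?thesis
    using assms by (intro that[of "i - 1"]) (auto simp: rim_pair_def elim!: evenE)
next
  case False
  then obtain k where "i = 2 * k + 1"
    by (elim oddE)
  then show ?thesis
    using assms by (intro that[of "i + 1"]) (auto simp: rim_pair_def intro!: exI[of _ "Suc k"])
qed

lemma rim_pairD:
  assumes "rim_pair n a b"
  shows "a \<noteq> b" "0 < a" "0 < b" "a \<le> 2 * n" "b \<le> 2 * n"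
  using assms unfolding rim_pair_def by auto

lemma rim_pair_edges:
  assumes "rim_pair n a b"
  shows "{0, a} \<in> edges (friendship_graph n)" "{a, b} \<in> edges (friendship_graph n)"
proof -
  show "{0, a} \<in> edges (friendship_graph n)"
    using rim_pairD[OF assms] by (auto simp: edges_friendship_graph)
  show "{a, b} \<in> edges (friendship_graph n)"
    using assms unfolding rim_pair_def edges_friendship_graph by (auto simp: insert_commute)
qed

text \<open>Outer vertices of the friendship graph have degree two: one hub edge and one rim
  edge.\<close>

lemma incident_edge_cases:
  assumes "rim_pair n a b" "e \<in> edges (friendship_graph n)" "a \<in> e"
  shows "e = {0, a} \<or> e = {a, b}"
proof -
  consider i where "e = {0, i}" | k where "1 \<le> k" "e = {2 * k - 1, 2 * k}"
    using assms(2) by (auto simp: edges_friendship_graph)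
  then show ?thesis
  proof cases
    case 1
    then show ?thesis
      using assms(3) rim_pairD[OF assms(1)] by auto
  next
    case (2 k)
    obtain l where l: "1 \<le> l" "a = 2 * l - 1 \<and> b = 2 * l \<or> a = 2 * l \<and> b = 2 * l - 1"
      using assms(1) unfolding rim_pair_def by auto
    moreover have "a = 2 * k - 1 \<or> a = 2 * k"
      using assms(3) 2 by auto
    \<comment> \<open>Either end of a rim edge determines its index by this formula, so two rim
      edges through \<open>a\<close> coincide.\<close>
    ultimately have "l = (a + 1) div 2" "k = (a + 1) div 2"
      using 2(1) by auto
    then have "l = k"
      by simp
    then show ?thesis
      using l 2 by (auto simp: insert_commute)
  qed
qed

lemma middle_arc_Inl:
  assumes "(Inl v, x) \<in> parcs (middle_graph G)"
  obtains e where "x = Inr e" "e \<in> edges G" "v \<in> e"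
  using assms by (auto simp: middle_graph_def)

lemma middle_arc_outer:
  assumes "rim_pair n a b" "(Inl a, x) \<in> parcs (middle_graph (friendship_graph n))"
  shows "x = Inr {0, a} \<or> x = Inr {a, b}"
  using assms(2) by (rule middle_arc_Inl) (use incident_edge_cases[OF assms(1)] in auto)

text \<open>A rim edge has no neighbour outside its block, so whatever dominates it is counted in
  that block.\<close>

lemma middle_arc_rim:
  assumes ab: "rim_pair n a b"
    and arc: "(Inr {a, b}, x) \<in> parcs (middle_graph (friendship_graph n))"
  shows "x \<in> {Inl a, Inl b, Inr {0, a}, Inr {0, b}}"
proof -
  consider (vertex) v where "x = Inl v" "v \<in> {a, b}"
    | (edge) f where "x = Inr f" "f \<in> edges (friendship_graph n)" "f \<noteq> {a, b}" "{a, b} \<inter> f \<noteq> {}"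
    using arc by (auto simp: middle_graph_def)
  then show ?thesis
  proof cases
    case vertex
    then show ?thesis by auto
  next
    case edge
    then have "f = {0, a} \<or> f = {0, b}"
      using incident_edge_cases[OF ab] incident_edge_cases[OF ab[unfolded rim_pair_commute[of n a]]]
      by (auto simp: insert_commute)
    then show ?thesis
      using edge by auto
  qed
qed

lemma middle_arc_hub:
  assumes "(Inl 0, x) \<in> parcs (middle_graph (friendship_graph n))"
  obtains i where "1 \<le> i" "i \<le> 2 * n" "x = Inr {0, i}"
  using assms by (rule middle_arc_Inl) (auto simp: edges_friendship_graph doubleton_eq_iff)

definition block :: "nat \<Rightarrow> nat \<Rightarrow> (nat + nat set) set" where
  "block a b = {Inl a, Inl b, Inr {0, a}, Inr {0, b}, Inr {a, b}}"

lemma block_commute: "block a b = block b a"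
  by (auto simp: block_def insert_commute)

lemma finite_block: "finite (block a b)"
  by (simp add: block_def)

lemma blocks_disjoint:
  assumes "1 \<le> k" "1 \<le> l" "k \<noteq> l"
  shows "block (2 * k - 1) (2 * k) \<inter> block (2 * l - 1) (2 * l) = {}"
proof -
  have "2 * k - 1 \<noteq> 2 * l" "2 * k \<noteq> 2 * l - 1" "2 * k - 1 \<noteq> 2 * l - 1"
    using assms by presburger+
  then show ?thesis
    using assms by (auto simp: block_def doubleton_eq_iff)
qed

section \<open>The lower bound\<close>

lemma total_dominating_set_block:
  assumes D: "total_dominating_set (middle_graph (friendship_graph n)) D" and ab: "rim_pair n a b"
  shows "2 \<le> card (D \<inter> block a b)"
proof -
  let ?M = "middle_graph (friendship_graph n)"
  have dom: "\<exists>u\<in>D. (v, u) \<in> parcs ?M" if "v \<in> pverts ?M" for v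
    using D that by (auto simp: total_dominating_set_def)
  have ba: "rim_pair n b a"
    using ab by (simp add: rim_pair_commute)
  have verts: "Inl a \<in> pverts ?M" "Inl b \<in> pverts ?M" "Inr {a, b} \<in> pverts ?M"
    using rim_pairD[OF ab] rim_pair_edges[OF ab]
    by (auto simp: middle_graph_def pverts_friendship_graph)
  have two: "2 \<le> card (D \<inter> block a b)" if "x \<noteq> y" "{x, y} \<subseteq> D \<inter> block a b" for x y
    using card_mono[OF _ that(2)] that(1) by (simp add: finite_block)
  show ?thesis
  proof (cases "Inr {a, b} \<in> D")
    case True
    obtain u where "u \<in> D" "(Inr {a, b}, u) \<in> parcs ?M"
      using dom verts(3) by blast
    moreover from this(2) have "u \<in> {Inl a, Inl b, Inr {0, a}, Inr {0, b}}"
      using ab by (rule middle_arc_rim[rotated])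
    ultimately show ?thesis
      using True rim_pairD[OF ab]
      by (intro two[of u "Inr {a, b}"]) (auto simp: block_def doubleton_eq_iff)
  next
    case False
    \<comment> \<open>Without the rim edge, each outer vertex has only its own hub edge left to
      dominate it.\<close>
    then have "Inr {0, a} \<in> D" "Inr {0, b} \<in> D"
      using dom[OF verts(1)] dom[OF verts(2)] middle_arc_outer[OF ab] middle_arc_outer[OF ba]
      by (auto simp: insert_commute)
    then show ?thesis
      using rim_pairD[OF ab]
      by (intro two[of "Inr {0, a}" "Inr {0, b}"]) (auto simp: block_def doubleton_eq_iff)
  qed
qed

text \<open>Summing over disjoint blocks gives 2n \<le> sum \<le> \<open>card D\<close> \<le> 2n.
  Equality throughout means that the blocks exhaust \<open>D\<close> and that each contributes
  exactly two.\<close>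

lemma total_dominating_set_small:
  assumes D: "total_dominating_set (middle_graph (friendship_graph n)) D"
    and fin: "finite D" and small: "card D \<le> 2 * n"
  shows "Inl 0 \<notin> D" and "\<And>a b. rim_pair n a b \<Longrightarrow> card (D \<inter> block a b) = 2"
proof -
  define T where "T k = D \<inter> block (2 * k - 1) (2 * k)" for k
  have two: "2 \<le> card (T k)" if "k \<in> {1..n}" for k
    unfolding T_def using that by (intro total_dominating_set_block[OF D]) (auto simp: rim_pair_def)
  have "card (\<Union>k\<in>{1..n}. T k) = (\<Sum>k=1..n. card (T k))"
  proof (rule card_UN_disjoint)
    show "\<forall>k\<in>{1..n}. \<forall>l\<in>{1..n}. k \<noteq> l \<longrightarrow> T k \<inter> T l = {}"
      using blocks_disjoint by (fastforce simp: T_def)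
  qed (auto simp: T_def fin)
  moreover have sub: "(\<Union>k\<in>{1..n}. T k) \<subseteq> D"
    by (auto simp: T_def)
  then have "card (\<Union>k\<in>{1..n}. T k) \<le> card D"
    by (rule card_mono[OF fin])
  moreover have "(\<Sum>k=1..n. 2) \<le> (\<Sum>k=1..n. card (T k))"
    using two by (rule sum_mono)
  ultimately have sum: "(\<Sum>k=1..n. 2) = (\<Sum>k=1..n. card (T k))"
    and card: "card (\<Union>k\<in>{1..n}. T k) = card D"
    using small by simp_all
  have "(\<Union>k\<in>{1..n}. T k) = D"
    using fin sub card by (rule card_subset_eq)
  moreover have "Inl 0 \<notin> (\<Union>k\<in>{1..n}. T k)"
    by (auto simp: T_def block_def)
  ultimately show "Inl 0 \<notin> D"
    by simp
  show "card (D \<inter> block a b) = 2" if ab: "rim_pair n a b" for a b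
  proof -
    obtain k where k: "k \<in> {1..n}" "D \<inter> block a b = T k"
      using ab block_commute unfolding rim_pair_def T_def by fastforce
    \<comment> \<open>Every summand is at least 2 and the sums agree, so no summand can exceed
      2.\<close>
    have "2 = card (T k)"
      by (rule sum_mono_inv[OF sum two k(1)]) simp_all
    then show ?thesis
      using k by simp
  qed
qed

lemma total_outer_connected_dominating_set_card_ge:
  assumes "total_outer_connected_dominating_set (middle_graph (friendship_graph n)) D"
  shows "2 * n + 1 \<le> card D"
proof (rule ccontr)
  let ?M = "middle_graph (friendship_graph n)"
  assume "\<not> ?thesis"
  then have small: "card D \<le> 2 * n"
    by simp
  have pg: "pair_graph ?M"
    by (intro pair_graph_middle_graph pair_graph_friendship_graph)
  then interpret M: pair_graph ?M .
  have D: "total_dominating_set ?M D" and con: "connected (with_proj ?M \<restriction> (pverts ?M - D))"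
    using assms by (auto simp: total_outer_connected_dominating_set_def)
  then have sub: "D \<subseteq> pverts ?M" and dom: "\<And>v. v \<in> pverts ?M \<Longrightarrow> \<exists>u\<in>D. (v, u) \<in> parcs ?M"
    by (auto simp: total_dominating_set_def)
  have "finite D"
    using sub M.pair_finite_verts by (rule finite_subset)
  note tight = total_dominating_set_small[OF D this small]
  have hub: "Inl 0 \<in> pverts ?M"
    by (auto simp: middle_graph_def pverts_friendship_graph)
  \<comment> \<open>The neighbours of the centre are hub edges; one that dominates it selects the
    block to examine.\<close>
  obtain a where a: "1 \<le> a" "a \<le> 2 * n" "Inr {0, a} \<in> D"
    using dom[OF hub] by (auto elim: middle_arc_hub)
  then obtain b where ab: "rim_pair n a b"
    using rim_pair_exists by blast
  then have ba: "rim_pair n b a"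
    by (simp add: rim_pair_commute)
  note ne = rim_pairD[OF ab]
  have verts: "Inl a \<in> pverts ?M" "Inl b \<in> pverts ?M"
    using ne by (auto simp: middle_graph_def pverts_friendship_graph)
  have in_block: "Inl a \<in> block a b"
    by (simp add: block_def)
  have block: "D \<inter> block a b = {x, y}" if "x \<noteq> y" "{x, y} \<subseteq> D \<inter> block a b" for x y
    using card_subset_eq[OF _ that(2)] tight(2)[OF ab] that(1) by (simp add: finite_block)
  have separated: False
    \<comment> \<open>Tightness puts the centre outside \<open>D\<close>, so a set around
      \<open>Inl a\<close> with no exit avoiding \<open>D\<close> would disconnect the
      complement.\<close>
    if A: "Inl a \<in> A" "Inl 0 \<notin> A" "Inl a \<notin> D"
      and "\<And>x y. x \<in> A \<Longrightarrow> y \<notin> D \<Longrightarrow> (x, y) \<in> parcs ?M \<Longrightarrow> y \<in> A" for A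
    using connected_induce_closed[OF pg con, of "Inl a" A "Inl 0"] that hub verts tight(1) by auto
  obtain u where "u \<in> D" "(Inl b, u) \<in> parcs ?M"
    using dom[OF verts(2)] by blast
  \<comment> \<open>Whatever dominates \<open>Inl b\<close> is the second and last element of
    \<open>D\<close> in the block.\<close>
  then consider (hubs) "Inr {0, b} \<in> D" | (rim) "Inr {a, b} \<in> D"
    using middle_arc_outer[OF ba] by (auto simp: insert_commute)
  then show False
  proof cases
    case hubs
    then have "D \<inter> block a b = {Inr {0, a}, Inr {0, b}}"
      using a ne by (intro block) (auto simp: block_def doubleton_eq_iff)
    then have "Inl a \<notin> D \<inter> block a b"
      by simp
    then have "Inl a \<notin> D"
      using in_block by simp
    then show False
    \<comment> \<open>The only exits from this set are the two hub edges, both in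
      \<open>D\<close>.\<close>
    proof (rule separated[of "{Inl a, Inl b, Inr {a, b}}", rotated 2])
      fix x y
      assume "x \<in> {Inl a, Inl b, Inr {a, b}}" "y \<notin> D" "(x, y) \<in> parcs ?M"
      then show "y \<in> {Inl a, Inl b, Inr {a, b}}"
        using middle_arc_outer[OF ab] middle_arc_outer[OF ba] middle_arc_rim[OF ab] hubs a(3)
        by (auto simp: insert_commute)
    qed (use ne in auto)
  next
    case rim
    then have "D \<inter> block a b = {Inr {0, a}, Inr {a, b}}"
      using a ne by (intro block) (auto simp: block_def doubleton_eq_iff)
    then have "Inl a \<notin> D \<inter> block a b"
      by simp
    then have "Inl a \<notin> D"
      using in_block by simp
    then show False
    \<comment> \<open>Both neighbours of \<open>Inl a\<close> lie in \<open>D\<close>, so it is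
      isolated in the complement.\<close>
    proof (rule separated[of "{Inl a}", rotated 2])
      fix x y
      assume "x \<in> {Inl a}" "y \<notin> D" "(x, y) \<in> parcs ?M"
      then show "y \<in> {Inl a}"
        using middle_arc_outer[OF ab] rim a(3) by auto
    qed (use ne in auto)
  qed
qed

section \<open>The upper bound\<close>

text \<open>Rim edges dominate outer vertices and hub edges, odd outer vertices dominate rim edges,
  and \<open>{0, 1}\<close> dominates the centre. Deleting that hub edge strands no vertex, since
  vertex 1 is itself in the set.\<close>

definition witness :: "nat \<Rightarrow> (nat + nat set) set" where
  "witness n = insert (Inr {0, 1})
    ((\<lambda>k. Inl (2 * k - 1)) ` {1..n} \<union> (\<lambda>k. Inr {2 * k - 1, 2 * k}) ` {1..n})"

lemma card_witness: "card (witness n) = 2 * n + 1"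
proof -
  let ?V = "(\<lambda>k. Inl (2 * k - 1)) ` {1..n} :: (nat + nat set) set"
  let ?E = "(\<lambda>k. Inr {2 * k - 1, 2 * k}) ` {1..n} :: (nat + nat set) set"
  have "card ?V = n"
    by (subst card_image) (auto simp: inj_on_def)
  moreover have "card ?E = n"
    by (subst card_image) (auto simp: inj_on_def doubleton_eq_iff)
  moreover have "?V \<inter> ?E = {}"
    by auto
  ultimately have "card (?V \<union> ?E) = 2 * n"
    by (simp add: card_Un_disjoint)
  \<comment> \<open>A rim edge contains \<open>2 * k\<close>, which is at least 2.\<close>
  moreover have "{0, 1} \<noteq> {2 * k - 1, 2 * k}" if "k \<in> {1..n}" for k
    using that by (auto simp: doubleton_eq_iff)
  then have "Inr {0, 1} \<notin> ?V \<union> ?E"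
    by blast
  ultimately show ?thesis
    by (simp add: witness_def)
qed

lemma total_dominating_set_witness:
  assumes "1 \<le> n"
  shows "total_dominating_set (middle_graph (friendship_graph n)) (witness n)"
  unfolding total_dominating_set_def
proof (intro conjI ballI)
  let ?F = "friendship_graph n"
  have hub_edge: "{0, i} \<in> edges ?F" if "1 \<le> i" "i \<le> 2 * n" for i
    using that by (auto simp: edges_friendship_graph)
  have rim_edge: "{2 * k - 1, 2 * k} \<in> edges ?F" if "1 \<le> k" "k \<le> n" for k
    using that by (auto simp: edges_friendship_graph)
  show "witness n \<subseteq> pverts (middle_graph ?F)"
    using hub_edge[of 1] rim_edge assms
    by (auto simp: witness_def middle_graph_def pverts_friendship_graph)
  \<comment> \<open>The clause \<open>0 \<notin> e\<close> makes \<open>e\<close> differ from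
    \<open>{0, i}\<close>, as adjacency of two edges in the middle graph demands.\<close>
  have rim: "\<exists>u\<in>witness n. \<exists>e\<in>edges ?F. u = Inr e \<and> i \<in> e \<and> 0 \<notin> e" if i: "1 \<le> i" "i \<le> 2 * n" for i
  proof -
    obtain b where "rim_pair n i b"
      using i by (rule rim_pair_exists)
    then obtain k where "1 \<le> k" "k \<le> n" "i = 2 * k - 1 \<or> i = 2 * k"
      by (auto simp: rim_pair_def)
    then show ?thesis
      using rim_edge[of k]
      by (intro bexI[of _ "Inr {2 * k - 1, 2 * k}"] bexI[of _ "{2 * k - 1, 2 * k}"])
        (auto simp: witness_def)
  qed
  fix v
  assume "v \<in> pverts (middle_graph ?F)"
  then show "\<exists>u\<in>witness n. (v, u) \<in> parcs (middle_graph ?F)"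
  proof (cases rule: middle_vertex_cases)
    case centre
    then show ?thesis
      using hub_edge[of 1] assms
      by (intro bexI[of _ "Inr {0, 1}"]) (auto simp: witness_def middle_graph_def pverts_friendship_graph)
  next
    case (outer i)
    then obtain e where "Inr e \<in> witness n" "e \<in> edges ?F" "i \<in> e"
      using rim[of i] by blast
    then show ?thesis
      using outer by (intro bexI[of _ "Inr e"]) (auto simp: middle_graph_def pverts_friendship_graph)
  next
    case (hub i)
    then obtain e where "Inr e \<in> witness n" "e \<in> edges ?F" "i \<in> e" "0 \<notin> e"
      using rim[of i] by blast
    then show ?thesis
      using hub hub_edge[of i] by (intro bexI[of _ "Inr e"]) (auto simp: middle_graph_def)
  next
    case (rim k)
    then show ?thesis
      using rim_edge[of k]
      by (intro bexI[of _ "Inl (2 * k - 1)"])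
        (auto simp: witness_def middle_graph_def pverts_friendship_graph)
  qed
qed

text \<open>All remaining vertices are within two steps of the centre: hub edges touch it, and a
  remaining outer vertex reaches it through its own hub edge.\<close>

lemma connected_witness_complement:
  "connected (with_proj (middle_graph (friendship_graph n))
    \<restriction> (pverts (middle_graph (friendship_graph n)) - witness n))"
proof (rule connected_induceI)
  let ?F = "friendship_graph n"
  let ?M = "middle_graph ?F"
  let ?S = "pverts ?M - witness n"
  let ?R = "parcs ?M \<inter> ?S \<times> ?S"
  show "pair_graph ?M"
    by (intro pair_graph_middle_graph pair_graph_friendship_graph)
  show hub: "Inl 0 \<in> ?S"
    by (auto simp: middle_graph_def pverts_friendship_graph witness_def)
  have spoke: "(Inr {0, i}, Inl 0) \<in> ?R" if "Inr {0, i} \<in> ?S" for i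
    using that hub by (auto simp: middle_graph_def pverts_friendship_graph)
  fix u
  assume u: "u \<in> ?S"
  then have "u \<in> pverts ?M"
    by simp
  then show "(u, Inl 0) \<in> ?R\<^sup>*"
  proof (cases rule: middle_vertex_cases)
    case centre
    then show ?thesis by simp
  next
    case (outer i)
    have "even i"
    proof (rule ccontr)
      assume "odd i"
      then obtain k where "i = 2 * k + 1"
        by (elim oddE)
      then have "u \<in> witness n"
        using outer by (auto simp: witness_def intro!: image_eqI[of _ _ "Suc k"])
      then show False
        using u by simp
    qed
    \<comment> \<open>Parity separates this hub edge from the only one in the witness.\<close>
    then have "{0, i} \<noteq> {0, 1}"
      by (auto simp: doubleton_eq_iff)
    then have "Inr {0, i} \<notin> witness n"
      using outer by (auto simp: witness_def doubleton_eq_iff)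
    moreover have "{0, i} \<in> edges ?F"
      using outer by (auto simp: edges_friendship_graph)
    ultimately have "Inr {0, i} \<in> ?S" "(u, Inr {0, i}) \<in> ?R"
      using u outer by (auto simp: middle_graph_def pverts_friendship_graph)
    then show ?thesis
      using spoke by (blast intro: converse_rtrancl_into_rtrancl)
  next
    case (hub i)
    then show ?thesis
      using spoke u by blast
  next
    \<comment> \<open>All rim edges are in the witness, so this case is contradictory.\<close>
    case (rim k)
    then show ?thesis
      using u by (auto simp: witness_def)
  qed
qed

theorem theorem4p9:
  fixes n :: nat
  assumes "n \<ge> 2"
  shows "gamma_tc (middle_graph (friendship_graph n)) = 2 * n + 1"
proof -
  let ?M = "middle_graph (friendship_graph n)"
  let ?\<D> = "{D. total_outer_connected_dominating_set ?M D}"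
  interpret M: pair_graph ?M
    by (intro pair_graph_middle_graph pair_graph_friendship_graph)
  \<comment> \<open>\<open>Min\<close> is meaningful only on finite nonempty sets: finiteness comes
    from this inclusion, nonemptiness from the witness.\<close>
  have "?\<D> \<subseteq> Pow (pverts ?M)"
    by (auto simp: total_outer_connected_dominating_set_def total_dominating_set_def)
  then have "finite ?\<D>"
    by (rule finite_subset) simp
  moreover have "witness n \<in> ?\<D>"
    using assms total_dominating_set_witness connected_witness_complement
    by (simp add: total_outer_connected_dominating_set_def)
  then have "2 * n + 1 \<in> card ` ?\<D>"
    using card_witness[of n] by (metis image_eqI)
  ultimately show ?thesis
    unfolding gamma_tc_def
    by (intro Min_eqI) (auto dest: total_outer_connected_dominating_set_card_ge)
qed

end
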